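(* Consider the central-upwind semi-discretization of the one-dimensional Saint-Venant system (described in the context) with the piecewise linear minmod reconstruction corrected by the wet/dry reconstruction. Assume that the system of ODEs for the cell averages is solved by the forward Euler method with time step $\Delta t$, so that (in the first component, after subtracting $B_j$) $$\overline h_j^{\,n+1}=\overline h_j^{\,n}-\frac{\Delta t}{\Delta x}\left(H^{(1)}_{j+\frac12}-H^{(1)}_{j-\frac12}\right)\quad\text{for all } j,$$ with numerical fluxes evaluated from the data at time level $t^n$, and assume that $\overline h_j^{\,n}\ge 0$ for all $j$. Then: (i) $\overline h_j^{\,n+1}\ge 0$ for all $j$, provided that $$\Delta t\le \min_j\left\{\frac{\Delta x_j^\star}{2a_j}\right\},\qquad a_j:=\max\left\{a^+_{j+\frac12},\,-a^-_{j+\frac12}\right\}.\qquad(\ast)$$ (ii) Condition $(\ast)$ cannot be guaranteed by any finite positive CFL condition. That is, for every constant $\kappa>0$, the condition $\frac{\Delta t}{\Delta x}\max_j|a^\pm_{j+\frac12}|\le\kappa$ does not imply $(\ast)$: there exist a grid, a bottom topography, data with $\overline h_j^{\,n}\ge0$ for all $j$, and $\Delta t>0$ for which the former holds and $(\ast)$ fails.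
   Context: **System.** $h_t+(hu)_x=0$, $(hu)_t+(hu^2+\frac12 gh^2)_x=-ghB_x$, where $h$ is the water depth, $u$ the velocity, $g>0$ the gravitational constant, $B(x)$ the bottom, and $w:=h+B$ the free surface. **Grid and bottom.** Uniform grid $x_\alpha=\alpha\Delta x$, cells $I_j=[x_{j-\frac12},x_{j+\frac12}]$, $j\in\mathbb Z$. The bottom is replaced by the continuous piecewise linear function interpolating the values $B_{j+\frac12}=\frac12(B(x_{j+\frac12}+0)+B(x_{j+\frac12}-0))$, and $B_j:=\frac12(B_{j+\frac12}+B_{j-\frac12})$. The unknowns are the cell averages $\overline{\mathbf U}_j=(\overline w_j,(\overline{hu})_j)$, and $\overline h_j:=\overline w_j-B_j$. The averaged velocity is $\overline u_j=(\overline{hu})_j/\overline h_j$ if $\overline h_j\ge\epsilon$ and $\overline u_j=0$ otherwise, where $\epsilon>0$ is a fixed small parameter ($\epsilon=10^{-9}$ in the numerical experiments). **Uncorrected reconstruction.** For $q\in\{w,u\}$: $\tilde q^-_{j+\frac12}=\overline q_j+\frac{\Delta x}{2}(q_x)_j$, $\tilde q^+_{j-\frac12}=\overline q_j-\frac{\Delta x}{2}(q_x)_j$, with $$(q_x)_j=\mathrm{minmod}\Big(\theta\tfrac{\overline q_j-\overline q_{j-1}}{\Delta x},\tfrac{\overline q_{j+1}-\overline q_{j-1}}{2\Delta x},\theta\tfrac{\overline q_{j+1}-\overline q_j}{\Delta x}\Big),\quad \theta\in[1,2].$$ Here minmod of several numbers is their minimum if all are positive, their maximum if all are negative, and $0$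 otherwise. **Wet/dry reconstruction.** The final values are $\mathbf U^\pm_{j+\frac12}=(w^\pm_{j+\frac12},h^\pm_{j+\frac12}u^\pm_{j+\frac12})$ with $h^\pm_{j+\frac12}=w^\pm_{j+\frac12}-B_{j+\frac12}$ and $u^\pm_{j+\frac12}=\tilde u^\pm_{j+\frac12}$. The values $w^+_{j-\frac12}$, $w^-_{j+\frac12}$ and the length $\Delta x_j^\star$ in cell $j$ are defined by cases. * *Case 1:* $\overline w_j\ge B_{j-\frac12}$ and $\overline w_j\ge B_{j+\frac12}$. Set $\Delta x_j^\star=\Delta x$. * 1A: if $\tilde w^+_{j-\frac12}\ge B_{j-\frac12}$ and $\tilde w^-_{j+\frac12}\ge B_{j+\frac12}$ (fully flooded cell), set $w^+_{j-\frac12}=\tilde w^+_{j-\frac12}$, $w^-_{j+\frac12}=\tilde w^-_{j+\frac12}$. * 1B: otherwise, if $\tilde w^-_{j+\frac12}<B_{j+\frac12}$, set $w^-_{j+\frac12}=B_{j+\frac12}$, $w^+_{j-\frac12}=2\overline w_j-B_{j+\frac12}$; if $\tilde w^+_{j-\frac12}<B_{j-\frac12}$, set $w^-_{j+\frac12}=2\overline w_j-B_{j-\frac12}$, $w^+_{j-\frac12}=B_{j-\frac12}$. * *Case 2:* $B_{j-\frac12}>\overline w_j>B_{j+\frac12}$. * 2A: if $\tilde w^+_{j+\frac12}>B_{j+\frac12}$ and $\tilde w^-_{j+\frac32}>B_{j+\frac32}$ (cell $j+1$ is fully flooded), set $w^-_{j+\frac12}=\tilde w^+_{j+\frac12}$,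 so $h^-_{j+\frac12}=\tilde w^+_{j+\frac12}-B_{j+\frac12}$; set $h^+_{j-\frac12}=\max\{0,2\overline h_j-h^-_{j+\frac12}\}$, $w^+_{j-\frac12}=h^+_{j-\frac12}+B_{j-\frac12}$, and $\Delta x_j^\star=\Delta x\cdot\min\{2\overline h_j/h^-_{j+\frac12},1\}$. * 2B: otherwise, let $w_j$ be the free surface of cell $j$, namely $w_j=\overline w_j$ if $\overline h_j\ge\frac12|B_{j+\frac12}-B_{j-\frac12}|$ and $w_j=B_{j+\frac12}+\sqrt{2\overline h_j|B_{j-\frac12}-B_{j+\frac12}|}$ otherwise (in Case 2 the second alternative holds). Set $h^-_{j+\frac12}=w_j-B_{j+\frac12}$, $w^-_{j+\frac12}=w_j$, $h^+_{j-\frac12}=0$, $w^+_{j-\frac12}=B_{j-\frac12}$, and $\Delta x_j^\star=\sqrt{2\overline h_j/(B_{j-\frac12}-B_{j+\frac12})}\,\Delta x$. * *Case 3:* $B_{j-\frac12}<\overline w_j<B_{j+\frac12}$: the mirror image of Case 2 (exchange the roles of the left and right edges, of cells $j+1$ and $j-1$, and of the superscripts $+$ and $-$). **Fluxes.** $$\mathbf H_{j+\frac12}=\frac{a^+_{j+\frac12}\mathbf F(\mathbf U^-_{j+\frac12},B_{j+\frac12})-a^-_{j+\frac12}\mathbf F(\mathbf U^+_{j+\frac12},B_{j+\frac12})}{a^+_{j+\frac12}-a^-_{j+\frac12}}+\frac{a^+_{j+\frac12}a^-_{j+\frac12}}{a^+_{j+\frac12}-a^-_{j+\frac12}}\big[\mathbf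 U^+_{j+\frac12}-\mathbf U^-_{j+\frac12}\big],$$ with $\mathbf F(\mathbf U,B)=\big(hu,\frac{(hu)^2}{w-B}+\frac g2(w-B)^2\big)^T$ and $$a^+_{j+\frac12}=\max\{u^+_{j+\frac12}+\sqrt{gh^+_{j+\frac12}},\,u^-_{j+\frac12}+\sqrt{gh^-_{j+\frac12}},\,0\},$$ $$a^-_{j+\frac12}=\min\{u^+_{j+\frac12}-\sqrt{gh^+_{j+\frac12}},\,u^-_{j+\frac12}-\sqrt{gh^-_{j+\frac12}},\,0\}.$$ $H^{(1)}$ denotes the first component of $\mathbf H$. Semi-discrete scheme: $\frac{d}{dt}\overline{\mathbf U}_j=-\frac{1}{\Delta x}(\mathbf H_{j+\frac12}-\mathbf H_{j-\frac12})+\overline{\mathbf S}_j$, with $\overline{\mathbf S}_j=\big(0,-g\overline h_j\frac{B_{j+\frac12}-B_{j-\frac12}}{\Delta x}\big)^T$. **Conventions.** If $a^+_{j+\frac12}=a^-_{j+\frac12}=0$ (which forces $h^\pm_{j+\frac12}=0$ and $u^\pm_{j+\frac12}=0$), then $\mathbf H_{j+\frac12}:=0$; $(hu)^2/(w-B)$ is read as $0$ when $w=B$; and $\Delta t\le\Delta x_j^\star/(2a_j)$ is read as $2a_j\Delta t\le\Delta x_j^\star$. Over infinitely many cells, max/min are read as sup/inf.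
   Formalization: Part (i) is false with the printed a_j; it is proved with a_j := max{a^+_{j+1/2}, -a^-_{j-1/2}} (second speed at the left edge of cell j). Part (ii) is proved for both the printed and the corrected a_j. *)

theory Defs
  imports "HOL-Analysis.Analysis"
begin

text \<open>
  Indexing: cells are indexed by \<open>j :: int\<close>, and the interface at \<open>x\<^bsub>j+1/2\<^esub>\<close> is indexed by the
  cell \<open>j\<close> on its left. So \<open>q j\<close> stands for \<open>q\<^bsub>j+1/2\<^esub>\<close> if \<open>q\<close> is an interface quantity, and the
  left edge \<open>x\<^bsub>j-1/2\<^esub>\<close> of the cell \<open>j\<close> is the interface \<open>j - 1\<close>.
\<close>

record sv_setup =
  grav :: real
  eps :: real
  theta :: real
  dx :: real
  bottom :: "real \<Rightarrow> real"

text \<open>The cell averages \<open>j \<mapsto> (w, hu)\<close> at one time level.\<close>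

type_synonym sv_state = "int \<Rightarrow> real \<times> real"


subsection \<open>Grid and bottom\<close>

definition x_face :: "sv_setup \<Rightarrow> int \<Rightarrow> real" where
  "x_face P j = (of_int j + 1/2) * dx P"

definition B_face :: "sv_setup \<Rightarrow> int \<Rightarrow> real" where
  "B_face P j = (Lim (at_right (x_face P j)) (bottom P) + Lim (at_left (x_face P j)) (bottom P)) / 2"

definition B_cell :: "sv_setup \<Rightarrow> int \<Rightarrow> real" where
  "B_cell P j = (B_face P j + B_face P (j - 1)) / 2"

text \<open>The one-sided limits must exist for \<^const>\<open>B_face\<close> to be meaningful.\<close>

definition admissible :: "sv_setup \<Rightarrow> bool" where
  "admissible P \<longleftrightarrow> grav P > 0 \<and> eps P > 0 \<and> 1 \<le> theta P \<and> theta P \<le> 2 \<and> dx P > 0 \<and>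
     (\<forall>j. (\<exists>l. (bottom P \<longlongrightarrow> l) (at_right (x_face P j))) \<and>
          (\<exists>l. (bottom P \<longlongrightarrow> l) (at_left (x_face P j))))"


subsection \<open>Cell averages\<close>

definition w_bar :: "sv_state \<Rightarrow> int \<Rightarrow> real" where
  "w_bar U j = fst (U j)"

definition hu_bar :: "sv_state \<Rightarrow> int \<Rightarrow> real" where
  "hu_bar U j = snd (U j)"

definition h_bar :: "sv_setup \<Rightarrow> sv_state \<Rightarrow> int \<Rightarrow> real" where
  "h_bar P U j = w_bar U j - B_cell P j"

definition u_bar :: "sv_setup \<Rightarrow> sv_state \<Rightarrow> int \<Rightarrow> real" where
  "u_bar P U j = (if h_bar P U j \<ge> eps P then hu_bar U j / h_bar P U j else 0)"


subsection \<open>Uncorrected minmod reconstruction\<close>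

definition minmod :: "real set \<Rightarrow> real" where
  "minmod A = (if \<forall>z\<in>A. z > 0 then Min A else if \<forall>z\<in>A. z < 0 then Max A else 0)"

definition slope :: "sv_setup \<Rightarrow> (int \<Rightarrow> real) \<Rightarrow> int \<Rightarrow> real" where
  "slope P q j = minmod {theta P * ((q j - q (j - 1)) / dx P),
                         (q (j + 1) - q (j - 1)) / (2 * dx P),
                         theta P * ((q (j + 1) - q j) / dx P)}"

definition tilde_minus :: "sv_setup \<Rightarrow> (int \<Rightarrow> real) \<Rightarrow> int \<Rightarrow> real" where
  "tilde_minus P q j = q j + dx P / 2 * slope P q j"

definition tilde_plus :: "sv_setup \<Rightarrow> (int \<Rightarrow> real) \<Rightarrow> int \<Rightarrow> real" where
  "tilde_plus P q j = q (j + 1) - dx P / 2 * slope P q (j + 1)"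


subsection \<open>Wet/dry reconstruction\<close>

text \<open>In a sloping cell, the base point of the second alternative is the lower of the two edges.\<close>

definition free_surface :: "sv_setup \<Rightarrow> sv_state \<Rightarrow> int \<Rightarrow> real" where
  "free_surface P U j =
     (if h_bar P U j \<ge> 1/2 * \<bar>B_face P j - B_face P (j - 1)\<bar> then w_bar U j
      else min (B_face P j) (B_face P (j - 1))
             + sqrt (2 * h_bar P U j * \<bar>B_face P (j - 1) - B_face P j\<bar>))"

text \<open>
  The triple \<open>(w\<^sup>+\<^bsub>j-1/2\<^esub>, w\<^sup>-\<^bsub>j+1/2\<^esub>, \<Delta>x\<^sup>\<star>\<^bsub>j\<^esub>)\<close>. If \<open>h_bar P U j \<ge> 0\<close>, then the three cases are exhaustive
  and at least one of the two inequalities of the case distinction 1B fails, so that neither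
  \<^const>\<open>undefined\<close> nor the order of the tests matters.
\<close>

definition wet_dry :: "sv_setup \<Rightarrow> sv_state \<Rightarrow> int \<Rightarrow> real \<times> real \<times> real" where
  "wet_dry P U j =
    (let w = w_bar U j; h = h_bar P U j;
         BL = B_face P (j - 1); BR = B_face P j;
         tm = tilde_minus P (w_bar U); tp = tilde_plus P (w_bar U)
     in
     if w \<ge> BL \<and> w \<ge> BR then
       (if tp (j - 1) \<ge> BL \<and> tm j \<ge> BR then (tp (j - 1), tm j, dx P)
        else if tm j < BR then (2 * w - BR, BR, dx P)
        else (BL, 2 * w - BL, dx P))
     else if BL > w \<and> w > BR then
       (if tp j > BR \<and> tm (j + 1) > B_face P (j + 1) then
          (let hR = tp j - BR
           in (max 0 (2 * h - hR) + BL, tp j, dx P * min (2 * h / hR) 1))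
        else (BL, free_surface P U j, sqrt (2 * h / (BL - BR)) * dx P))
     else if BL < w \<and> w < BR then
       (if tm (j - 1) > BL \<and> tp (j - 2) > B_face P (j - 2) then
          (let hL = tm (j - 1) - BL
           in (tm (j - 1), max 0 (2 * h - hL) + BR, dx P * min (2 * h / hL) 1))
        else (free_surface P U j, BR, sqrt (2 * h / (BR - BL)) * dx P))
     else undefined)"

definition w_plus :: "sv_setup \<Rightarrow> sv_state \<Rightarrow> int \<Rightarrow> real" where
  "w_plus P U j = fst (wet_dry P U (j + 1))"

definition w_minus :: "sv_setup \<Rightarrow> sv_state \<Rightarrow> int \<Rightarrow> real" where
  "w_minus P U j = fst (snd (wet_dry P U j))"

definition dx_star :: "sv_setup \<Rightarrow> sv_state \<Rightarrow> int \<Rightarrow> real" where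
  "dx_star P U j = snd (snd (wet_dry P U j))"

definition h_plus :: "sv_setup \<Rightarrow> sv_state \<Rightarrow> int \<Rightarrow> real" where
  "h_plus P U j = w_plus P U j - B_face P j"

definition h_minus :: "sv_setup \<Rightarrow> sv_state \<Rightarrow> int \<Rightarrow> real" where
  "h_minus P U j = w_minus P U j - B_face P j"

definition u_plus :: "sv_setup \<Rightarrow> sv_state \<Rightarrow> int \<Rightarrow> real" where
  "u_plus P U j = tilde_plus P (u_bar P U) j"

definition u_minus :: "sv_setup \<Rightarrow> sv_state \<Rightarrow> int \<Rightarrow> real" where
  "u_minus P U j = tilde_minus P (u_bar P U) j"

definition U_plus :: "sv_setup \<Rightarrow> sv_state \<Rightarrow> int \<Rightarrow> real \<times> real" where
  "U_plus P U j = (w_plus P U j, h_plus P U j * u_plus P U j)"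

definition U_minus :: "sv_setup \<Rightarrow> sv_state \<Rightarrow> int \<Rightarrow> real \<times> real" where
  "U_minus P U j = (w_minus P U j, h_minus P U j * u_minus P U j)"


subsection \<open>Central-upwind flux\<close>

text \<open>Division by zero yields zero, as required where \<open>w = B\<close>.\<close>

definition flux :: "sv_setup \<Rightarrow> real \<times> real \<Rightarrow> real \<Rightarrow> real \<times> real" where
  "flux P V b = (case V of (w, m) \<Rightarrow> (m, m\<^sup>2 / (w - b) + grav P / 2 * (w - b)\<^sup>2))"

definition a_plus :: "sv_setup \<Rightarrow> sv_state \<Rightarrow> int \<Rightarrow> real" where
  "a_plus P U j = Max {u_plus P U j + sqrt (grav P * h_plus P U j),
                       u_minus P U j + sqrt (grav P * h_minus P U j), 0}"

definition a_minus :: "sv_setup \<Rightarrow> sv_state \<Rightarrow> int \<Rightarrow> real" where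
  "a_minus P U j = Min {u_plus P U j - sqrt (grav P * h_plus P U j),
                        u_minus P U j - sqrt (grav P * h_minus P U j), 0}"

definition num_flux :: "sv_setup \<Rightarrow> sv_state \<Rightarrow> int \<Rightarrow> real \<times> real" where
  "num_flux P U j =
    (let ap = a_plus P U j; am = a_minus P U j; b = B_face P j in
     if ap = 0 \<and> am = 0 then 0
     else (1 / (ap - am)) *\<^sub>R (ap *\<^sub>R flux P (U_minus P U j) b - am *\<^sub>R flux P (U_plus P U j) b)
          + (ap * am / (ap - am)) *\<^sub>R (U_plus P U j - U_minus P U j))"


subsection \<open>Semi-discrete scheme and forward Euler step\<close>

definition source :: "sv_setup \<Rightarrow> sv_state \<Rightarrow> int \<Rightarrow> real \<times> real" where
  "source P U j = (0, - grav P * h_bar P U j * ((B_face P j - B_face P (j - 1)) / dx P))"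

definition sv_rhs :: "sv_setup \<Rightarrow> sv_state \<Rightarrow> sv_state" where
  "sv_rhs P U j = - ((1 / dx P) *\<^sub>R (num_flux P U j - num_flux P U (j - 1))) + source P U j"

definition euler_step :: "sv_setup \<Rightarrow> real \<Rightarrow> sv_state \<Rightarrow> sv_state" where
  "euler_step P dt U j = U j + dt *\<^sub>R sv_rhs P U j"


subsection \<open>Time step restrictions\<close>

text \<open>
  \<open>a_cell\<close> takes the speeds of the waves leaving the cell \<open>j\<close>: \<open>a\<^sup>+\<close> at its right edge and \<open>- a\<^sup>-\<close> at
  its left edge. The original formulation takes both speeds at the right edge; this is \<open>a_face\<close>.
  For positivity it is not enough, since it does not control the outflow through the left edge of a
  partially flooded cell whose bottom rises to the right: see \<open>face_time_step_not_sufficient\<close> at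
  the end of this theory. Hence the positivity claim uses \<open>a_cell\<close>, while the claim about CFL
  conditions covers both.
\<close>

definition a_cell :: "sv_setup \<Rightarrow> sv_state \<Rightarrow> int \<Rightarrow> real" where
  "a_cell P U j = max (a_plus P U j) (- a_minus P U (j - 1))"

definition a_face :: "sv_setup \<Rightarrow> sv_state \<Rightarrow> int \<Rightarrow> real" where
  "a_face P U j = max (a_plus P U j) (- a_minus P U j)"

definition time_step_ok :: "(sv_setup \<Rightarrow> sv_state \<Rightarrow> int \<Rightarrow> real) \<Rightarrow> sv_setup \<Rightarrow> sv_state \<Rightarrow> real \<Rightarrow> bool" where
  "time_step_ok a P U dt \<longleftrightarrow> (\<forall>j. 2 * a P U j * dt \<le> dx_star P U j)"

text \<open>The supremum is taken in the extended reals, so it is \<open>\<infinity>\<close> for unbounded speeds.\<close>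

definition cfl :: "sv_setup \<Rightarrow> sv_state \<Rightarrow> real \<Rightarrow> real \<Rightarrow> bool" where
  "cfl P U dt \<kappa> \<longleftrightarrow>
     ereal (dt / dx P) * (SUP j. ereal (max \<bar>a_plus P U j\<bar> \<bar>a_minus P U j\<bar>)) \<le> ereal \<kappa>"

lemma minmod_zero: "0 \<in> A \<Longrightarrow> minmod A = 0"
  unfolding minmod_def by force

lemma B_face_cont:
  assumes "continuous_on UNIV (bottom P)"
  shows "B_face P j = bottom P (x_face P j)"
proof -
  have "isCont (bottom P) (x_face P j)"
    using assms by (simp add: continuous_on_eq_continuous_at)
  then have "(bottom P \<longlongrightarrow> bottom P (x_face P j)) (at_right (x_face P j))"
    "(bottom P \<longlongrightarrow> bottom P (x_face P j)) (at_left (x_face P j))"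
    by (auto simp: isCont_def filterlim_at_split)
  then show ?thesis
    by (simp add: B_face_def tendsto_Lim)
qed

lemma admissible_cont:
  assumes "continuous_on UNIV (bottom P)" "grav P > 0" "eps P > 0" "1 \<le> theta P" "theta P \<le> 2"
    "dx P > 0"
  shows "admissible P"
proof -
  have "isCont (bottom P) x" for x
    using assms(1) by (simp add: continuous_on_eq_continuous_at)
  then show ?thesis
    using assms by (auto simp: admissible_def isCont_def filterlim_at_split)
qed

text \<open>
  The data consist of two flat dry plains, joined by one partially flooded cell (\<open>j = 0\<close>) with bottom
  rising from \<open>0\<close> to \<open>1\<close>. Its water runs off through the left edge, but \<open>a_face\<close> vanishes in that cell.
\<close>

lemma face_time_step_not_sufficient:
  "\<exists>P U dt. admissible P \<and> dt > 0 \<and> (\<forall>j. h_bar P U j \<ge> 0) \<and> time_step_ok a_face P U dt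
     \<and> \<not> (\<forall>j. h_bar P (euler_step P dt U) j \<ge> 0)"
proof -
  define P where "P = \<lparr>grav = 4, eps = 1, theta = 1, dx = 1,
    bottom = (\<lambda>x. max 0 (min 1 (x + 1/2)))\<rparr>"
  define U :: sv_state where "U = (\<lambda>j. (if j < 0 then 0 else if j = 0 then 17/32 else 1, 0))"
  have P: "grav P = 4" "eps P = 1" "theta P = 1" "dx P = 1"
    "bottom P = (\<lambda>x. max 0 (min 1 (x + 1/2)))"
    by (simp_all add: P_def)
  have cont: "continuous_on UNIV (bottom P)"
    unfolding P by (intro continuous_intros)
  have B: "B_face P j = (if j < 0 then 0 else 1)" for j
    unfolding B_face_cont[OF cont] by (auto simp: P x_face_def min_def max_def)
  have w: "w_bar U j = (if j < 0 then 0 else if j = 0 then 17/32 else 1)" for j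
    by (simp add: w_bar_def U_def)
  have h: "h_bar P U j = (if j = 0 then 1/32 else 0)" for j
    by (auto simp: h_bar_def w B_cell_def B)
  have u: "u_bar P U j = 0" for j
    by (simp add: u_bar_def hu_bar_def U_def)
  have sl: "slope P (w_bar U) j = 0" if "j \<noteq> 0" for j
    unfolding slope_def by (rule minmod_zero) (use that in \<open>auto simp: w\<close>)
  have slu: "slope P (u_bar P U) j = 0" for j
    unfolding slope_def by (rule minmod_zero) (auto simp: u)
  have u_pm: "u_plus P U j = 0" "u_minus P U j = 0" for j
    by (simp_all add: u_plus_def u_minus_def tilde_plus_def tilde_minus_def u slu)
  have fs: "free_surface P U 0 = 1/4"
    by (simp add: free_surface_def h B real_sqrt_divide)
  have wd: "wet_dry P U j = (if j < 0 then (0, 0, 1) else if j = 0 then (1/4, 1, 1/4) else (1, 1, 1))"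
    for j
    by (auto simp: wet_dry_def Let_def w h B tilde_minus_def tilde_plus_def sl P fs real_sqrt_divide)
  have h_pm: "h_plus P U j = (if j = -1 then 1/4 else 0)" "h_minus P U j = 0" for j
    by (auto simp: h_plus_def h_minus_def w_plus_def w_minus_def wd B)
  have a: "a_plus P U j = (if j = -1 then 1 else 0)" "a_minus P U j = (if j = -1 then -1 else 0)" for j
    by (simp_all add: a_plus_def a_minus_def u_pm h_pm P)
  have H: "fst (num_flux P U j) = (if j = -1 then -1/8 else 0)" for j
    by (simp add: num_flux_def Let_def a flux_def U_plus_def U_minus_def u_pm h_pm w_plus_def
        w_minus_def wd)
  have ok: "time_step_ok a_face P U (1/2)"
    by (auto simp: time_step_ok_def a_face_def a dx_star_def wd)
  have "fst (euler_step P (1/2) U 0) = 15/32"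
    using w[of 0] by (simp add: euler_step_def sv_rhs_def source_def H P w_bar_def)
  then have neg: "h_bar P (euler_step P (1/2) U) 0 < 0"
    by (simp add: h_bar_def w_bar_def B_cell_def B)
  have adm: "admissible P"
    by (rule admissible_cont[OF cont]) (simp_all add: P)
  show ?thesis
    using adm ok neg h by (intro exI[of _ P] exI[of _ U] exI[of _ "1/2"]) (auto simp: not_le)
qed

end

(*
  The first flux component splits into outgoing contributions,
    H = a+ h- (u- - a-)/(a+ - a-) + a- h+ (a+ - u+)/(a+ - a-),
  whose weights lie in [0,1]. So the outflow of a cell through its right and left edges is at most
  a (h-_right + h+_left) with a as in a_cell, and in each case of the wet/dry reconstruction
  dx_star is such that  dx_star * (h-_right + h+_left) <= 2 * dx * h_bar.  This gives positivity.

  For the negative claim, a partially flooded cell between two dry plains has dx_star / dx = s,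
  where s is the water depth at its lower edge, while its CFL number does not involve dx_star.
  Taking s below twice the given CFL number violates the time step restriction.
*)
theory Submission
  imports Defs
begin

lemma tilde_sum: "tilde_plus P q (j - 1) + tilde_minus P q j = 2 * q j"
  by (simp add: tilde_plus_def tilde_minus_def)

lemma h_bar_eq: "2 * h_bar P U j = 2 * w_bar U j - B_face P j - B_face P (j - 1)"
  by (simp add: h_bar_def B_cell_def field_simps)

text \<open>Half of \<open>dx_star\<close> times the sum of the two edge depths is the area of the
  trapezoid or triangle of water placed in the cell. The reconstruction conserves the volume
  \<open>dx P * h_bar P U j\<close>, so the bound is in fact attained in every case.\<close>

lemma wet_dry_bounds:
  assumes adm: "admissible P" and h0: "h_bar P U j \<ge> 0"
  shows "h_plus P U (j - 1) \<ge> 0 \<and> h_minus P U j \<ge> 0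
    \<and> dx_star P U j * (h_minus P U j + h_plus P U (j - 1)) \<le> 2 * dx P * h_bar P U j"
proof -
  define h w BL BR where defs: "h = h_bar P U j" "w = w_bar U j"
    "BL = B_face P (j - 1)" "BR = B_face P j"
  have dx: "dx P > 0"
    using adm by (simp add: admissible_def)
  have h: "h \<ge> 0" "2 * h = 2 * w - BR - BL"
    using h0 h_bar_eq[of P U j] by (simp_all add: defs)
  \<comment> \<open>Cases 2A and 3A, with \<open>d\<close> the depth at the lower edge. If
    \<open>2 * h < d\<close>, the water is a triangle that ends before the higher edge.\<close>
  have A: "0 \<le> max 0 (2 * h - d) \<and> 0 \<le> d
      \<and> dx P * min (2 * h / d) 1 * (d + max 0 (2 * h - d)) \<le> 2 * dx P * h" if "d > 0" for d
  proof (cases "2 * h \<ge> d")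
    case True
    then show ?thesis using that by (simp add: min_def max_def field_simps)
  next
    case False
    then show ?thesis using that by (simp add: min_def max_def field_simps)
  qed
  \<comment> \<open>Cases 2B and 3B: a triangle of water over a bottom drop
    \<open>D\<close>.\<close>
  have B: "sqrt (2 * h / D) * dx P * sqrt (2 * h * D) \<le> 2 * dx P * h" if "D > 0" for D
  proof -
    have "sqrt (2 * h / D) * sqrt (2 * h * D) = sqrt ((2 * h)\<^sup>2)"
      using that by (simp add: real_sqrt_mult[symmetric] power2_eq_square)
    also have "\<dots> = 2 * h" using h by simp
    finally show ?thesis by (simp add: mult_ac)
  qed
  note unf = h_plus_def h_minus_def w_plus_def w_minus_def dx_star_def wet_dry_def Let_def
    defs[symmetric]
  consider "w \<ge> BL" "w \<ge> BR" | "BL > w" "w > BR" | "BL < w" "w < BR"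
    using h by linarith
  then show ?thesis
  proof cases
    case 1
    \<comment> \<open>In case 1A linearity of the reconstruction keeps the average; in 1B one depth
      is set to 0 and the other to \<open>2 * h\<close>.\<close>
    have "tilde_plus P (w_bar U) (j - 1) + tilde_minus P (w_bar U) j = 2 * w"
      using tilde_sum[of P "w_bar U" j] by (simp add: defs)
    then have "h_plus P U (j - 1) \<ge> 0 \<and> h_minus P U j \<ge> 0 \<and> dx_star P U j = dx P
        \<and> h_minus P U j + h_plus P U (j - 1) = 2 * h"
      using 1 h by (auto simp: unf)
    then show ?thesis by (simp add: defs)
  next
    case 2
    have ne: "\<not> (w \<ge> BL \<and> w \<ge> BR)" using 2 by simp
    \<comment> \<open>The surface average lies below the higher edge, which puts
      \<open>free_surface\<close> in its square-root branch.\<close>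
    have lt: "\<not> 1/2 * \<bar>BR - BL\<bar> \<le> h" using 2 h by simp
    have fs: "free_surface P U j = BR + sqrt (2 * h * (BL - BR))"
      using 2 lt by (simp add: free_surface_def defs[symmetric])
    show ?thesis
      using 2 ne A[of "tilde_plus P (w_bar U) j - BR"] B[of "BL - BR"] h(1)
      by (auto simp: unf fs)
  next
    case 3
    have ne: "\<not> (w \<ge> BL \<and> w \<ge> BR)" "\<not> (BL > w \<and> w > BR)" using 3 by simp_all
    have lt: "\<not> 1/2 * \<bar>BR - BL\<bar> \<le> h" using 3 h by simp
    have fs: "free_surface P U j = BL + sqrt (2 * h * (BR - BL))"
      using 3 lt by (simp add: free_surface_def defs[symmetric])
    show ?thesis
      using 3 ne A[of "tilde_minus P (w_bar U) (j - 1) - BL"] B[of "BR - BL"] h(1)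
      by (auto simp: unf fs add.commute)
  qed
qed

lemma num_flux_bounds:
  assumes g: "grav P \<ge> 0" and hp: "h_plus P U j \<ge> 0" and hm: "h_minus P U j \<ge> 0"
  shows "fst (num_flux P U j) \<le> a_plus P U j * h_minus P U j"
    and "a_minus P U j * h_plus P U j \<le> fst (num_flux P U j)"
proof -
  define ap am p m up um where defs: "ap = a_plus P U j" "am = a_minus P U j"
    "p = h_plus P U j" "m = h_minus P U j" "up = u_plus P U j" "um = u_minus P U j"
  have s: "sqrt (grav P * p) \<ge> 0" "sqrt (grav P * m) \<ge> 0"
    using assms by (simp_all add: defs)
  have ap: "ap \<ge> 0" "up \<le> ap" "um \<le> ap" and am: "am \<le> 0" "am \<le> up" "am \<le> um"
    using s unfolding a_plus_def a_minus_def defs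
    by (auto simp: le_max_iff_disj min_le_iff_disj)
  have pm: "p \<ge> 0" "m \<ge> 0" using hp hm by (simp_all add: defs)
  have "fst (num_flux P U j) \<le> ap * m \<and> am * p \<le> fst (num_flux P U j)"
  proof (cases "ap = 0 \<and> am = 0")
    case True
    then show ?thesis by (simp add: num_flux_def Let_def defs[symmetric])
  next
    case False
    then have d: "ap - am > 0" using ap am by linarith
    have "w_plus P U j - w_minus P U j = p - m"
      by (simp add: defs h_plus_def h_minus_def)
    then have "fst (num_flux P U j) = (ap * (m * um) - am * (p * up)) / (ap - am)
        + ap * am / (ap - am) * (p - m)"
      using False by (auto simp: num_flux_def Let_def flux_def U_plus_def U_minus_def defs[symmetric])
    then have eq: "(ap - am) * fst (num_flux P U j) = ap * m * (um - am) + am * p * (ap - up)"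
      using d by (simp add: distrib_left) (simp add: algebra_simps)
    \<comment> \<open>Since \<open>um\<close> and \<open>up\<close> lie in \<open>[am, ap]\<close>,
      the first term of \<open>eq\<close> is nonnegative and the second nonpositive. Each of the two
      claimed bounds drops one term by its sign and estimates the weight of the other by
      \<open>ap - am\<close>.\<close>
    have "ap * m * (um - am) \<le> ap * m * (ap - am)" "0 \<le> ap * m * (um - am)"
      using ap am pm by (auto intro!: mult_left_mono mult_nonneg_nonneg)
    moreover have "- am * p * (ap - up) \<le> - am * p * (ap - am)" "0 \<le> - am * p * (ap - up)"
      using ap am pm by (intro mult_left_mono mult_nonneg_nonneg; simp)+
    ultimately have "(ap - am) * fst (num_flux P U j) \<le> (ap - am) * (ap * m)"
      "(ap - am) * (am * p) \<le> (ap - am) * fst (num_flux P U j)"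
      unfolding eq by (simp_all add: mult_ac)
    then show ?thesis using d by simp
  qed
  then show "fst (num_flux P U j) \<le> a_plus P U j * h_minus P U j"
    "a_minus P U j * h_plus P U j \<le> fst (num_flux P U j)"
    by (simp_all add: defs)
qed

lemma h_bar_euler_step:
  "h_bar P (euler_step P dt U) j =
    h_bar P U j - dt / dx P * (fst (num_flux P U j) - fst (num_flux P U (j - 1)))"
  by (simp add: h_bar_def w_bar_def euler_step_def sv_rhs_def source_def)

lemma euler_step_nonneg:
  assumes adm: "admissible P" and dt: "dt > 0" and h: "\<And>j. h_bar P U j \<ge> 0"
    and ok: "time_step_ok a_cell P U dt"
  shows "h_bar P (euler_step P dt U) j \<ge> 0"
proof -
  define a S where defs: "a = a_cell P U j" "S = h_minus P U j + h_plus P U (j - 1)"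
  have g: "grav P \<ge> 0" and dx: "dx P > 0"
    using adm by (simp_all add: admissible_def)
  have hp: "h_plus P U i \<ge> 0" and hm: "h_minus P U i \<ge> 0" for i
    using wet_dry_bounds[OF adm h, of "i + 1"] wet_dry_bounds[OF adm h, of i] by simp_all
  have S: "S \<ge> 0" "dx_star P U j * S \<le> 2 * dx P * h_bar P U j"
    using wet_dry_bounds[OF adm h, of j] by (simp_all add: defs)
  \<comment> \<open>These are the two outflow speeds of cell \<open>j\<close>; inflow through either
    edge can only help.\<close>
  have "a_plus P U j * h_minus P U j \<le> a * h_minus P U j"
    "- a_minus P U (j - 1) * h_plus P U (j - 1) \<le> a * h_plus P U (j - 1)"
    by (intro mult_right_mono hp hm; simp add: defs a_cell_def)+
  then have "fst (num_flux P U j) - fst (num_flux P U (j - 1)) \<le> a * S"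
    using num_flux_bounds(1)[OF g hp hm, of j] num_flux_bounds(2)[OF g hp hm, of "j - 1"]
    by (simp add: defs(2) distrib_left)
  then have "dt * (fst (num_flux P U j) - fst (num_flux P U (j - 1))) \<le> dt * (a * S)"
    using dt by simp
  moreover have "2 * a * dt * S \<le> dx_star P U j * S"
    using ok S(1) by (intro mult_right_mono) (auto simp: time_step_ok_def defs(1))
  ultimately have "dt * (fst (num_flux P U j) - fst (num_flux P U (j - 1))) \<le> dx P * h_bar P U j"
    using S(2) by (simp add: mult_ac)
  then show ?thesis
    using dx by (simp add: h_bar_euler_step field_simps)
qed

lemma cfl_not_sufficient:
  fixes \<kappa> g \<epsilon> \<theta> :: real
  assumes "\<kappa> > 0" "g > 0" "\<epsilon> > 0" "1 \<le> \<theta>" "\<theta> \<le> 2"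
  shows "\<exists>P U dt. admissible P \<and> grav P = g \<and> eps P = \<epsilon> \<and> theta P = \<theta>
           \<and> dt > 0 \<and> (\<forall>j. h_bar P U j \<ge> 0) \<and> cfl P U dt \<kappa>
           \<and> \<not> time_step_ok a_cell P U dt \<and> \<not> time_step_ok a_face P U dt"
proof -
  \<comment> \<open>\<open>s\<close> will be the depth at the lower edge and also the relative wet
    length of cell 0. It must be below 1 for a partially flooded cell and below
    \<open>2 * \<kappa>\<close> to violate the time step restriction.\<close>
  define s where "s = min (1/2) \<kappa>"
  have s: "0 < s" "s < 1" "s < 2 * \<kappa>"
    using assms by (auto simp: s_def min_def)
  have s2: "0 < s\<^sup>2" "s\<^sup>2 < 1"
    using s by (simp_all add: power_less_one_iff)
  define P where "P = \<lparr>grav = g, eps = \<epsilon>, theta = \<theta>, dx = 1,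
    bottom = (\<lambda>x. max 0 (min 1 (1/2 - x)))\<rparr>"
  \<comment> \<open>On the unit ramp across cell 0, this average leaves volume
    \<open>s\<^sup>2 / 2\<close>: a triangle of water with depth and length
    \<open>s\<close>.\<close>
  define U :: sv_state where "U = (\<lambda>j. (if j < 0 then 1 else if j = 0 then (1 + s\<^sup>2) / 2 else 0, 0))"
  define c where "c = sqrt (g * s)"
  \<comment> \<open>\<open>c\<close> is the only nonzero wave speed, so this uses up the CFL bound
    exactly.\<close>
  define dt where "dt = \<kappa> / c"
  have c: "c > 0" using assms s by (simp add: c_def)
  have dt: "dt > 0" "dt * c = \<kappa>" using c assms by (simp_all add: dt_def)
  have P: "grav P = g" "eps P = \<epsilon>" "theta P = \<theta>" "dx P = 1"
    "bottom P = (\<lambda>x. max 0 (min 1 (1/2 - x)))"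
    by (simp_all add: P_def)
  have cont: "continuous_on UNIV (bottom P)"
    unfolding P by (intro continuous_intros)
  have B: "B_face P j = (if j < 0 then 1 else 0)" for j
    unfolding B_face_cont[OF cont] by (auto simp: P x_face_def min_def max_def)
  have w: "w_bar U j = (if j < 0 then 1 else if j = 0 then (1 + s\<^sup>2) / 2 else 0)" for j
    by (simp add: w_bar_def U_def)
  have h: "h_bar P U j = (if j = 0 then s\<^sup>2 / 2 else 0)" for j
    by (auto simp: h_bar_def w B_cell_def B field_simps)
  have u: "u_bar P U j = 0" for j
    by (simp add: u_bar_def hu_bar_def U_def)
  \<comment> \<open>Away from cell 0 one of the adjacent differences is zero, which makes minmod
    vanish.\<close>
  have sl: "slope P (w_bar U) j = 0" if "j \<noteq> 0" for j
    unfolding slope_def by (rule minmod_zero) (use that in \<open>auto simp: w\<close>)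
  have slu: "slope P (u_bar P U) j = 0" for j
    unfolding slope_def by (rule minmod_zero) (auto simp: u)
  have u_pm: "u_plus P U j = 0" "u_minus P U j = 0" for j
    by (simp_all add: u_plus_def u_minus_def tilde_plus_def tilde_minus_def u slu)
  have fs: "free_surface P U 0 = s"
    using s s2 by (simp add: free_surface_def h B)
  have w0: "(1 + s\<^sup>2) / 2 < 1" "0 < (1 + s\<^sup>2) / 2" using s2 by (simp_all add: add_pos_nonneg)
  have wd: "wet_dry P U j = (if j < 0 then (1, 1, 1) else if j = 0 then (1, s, s) else (0, 0, 1))" for j
  proof -
    \<comment> \<open>Cell 1 is dry, so its left edge value equals the bottom, the test of case 2A
      fails and 2B applies.\<close>
    have "wet_dry P U 0 = (1, s, s)"
      using w0 s by (simp add: wet_dry_def Let_def w h B tilde_minus_def tilde_plus_def sl P fs)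
    moreover have "wet_dry P U j = (1, 1, 1)" if "j < 0"
      using that by (simp add: wet_dry_def Let_def w h B tilde_minus_def tilde_plus_def sl P)
    moreover have "wet_dry P U j = (0, 0, 1)" if "j > 0"
      using that by (simp add: wet_dry_def Let_def w h B tilde_minus_def tilde_plus_def sl P)
    ultimately show ?thesis by auto
  qed
  have h_pm: "h_plus P U j = 0" "h_minus P U j = (if j = 0 then s else 0)" for j
    by (auto simp: h_plus_def h_minus_def w_plus_def w_minus_def wd B)
  have a: "a_plus P U j = (if j = 0 then c else 0)" "a_minus P U j = (if j = 0 then - c else 0)" for j
    using c by (simp_all add: a_plus_def a_minus_def u_pm h_pm P c_def[symmetric])
  have "(SUP j. ereal (max \<bar>a_plus P U j\<bar> \<bar>a_minus P U j\<bar>)) \<le> ereal c"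
    using c by (intro SUP_least) (simp add: a)
  then have "ereal dt * (SUP j. ereal (max \<bar>a_plus P U j\<bar> \<bar>a_minus P U j\<bar>)) \<le> ereal dt * ereal c"
    using dt by (intro ereal_mult_left_mono) simp_all
  then have cfl: "cfl P U dt \<kappa>"
    using dt by (simp add: cfl_def P)
  have "dx_star P U 0 < 2 * c * dt"
    using s dt by (simp add: dx_star_def wd mult_ac)
  \<comment> \<open>The ramp falls to the right, so the wet edge is the right edge of cell 0, where
    \<open>a_cell\<close> and \<open>a_face\<close> both equal \<open>c\<close>.\<close>
  then have bad: "\<not> time_step_ok a_cell P U dt" "\<not> time_step_ok a_face P U dt"
    using c by (auto simp: time_step_ok_def a_cell_def a_face_def a not_le intro!: exI[of _ 0])
  have adm: "admissible P"
    by (rule admissible_cont[OF cont]) (use assms in \<open>simp_all add: P\<close>)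
  show ?thesis
    using adm dt cfl bad h s2
    by (intro exI[of _ P] exI[of _ U] exI[of _ dt]) (auto simp: P)
qed

theorem lemma4p1:
  shows "(\<forall>P U dt. admissible P \<and> dt > 0 \<and> (\<forall>j. h_bar P U j \<ge> 0) \<and> time_step_ok a_cell P U dt
            \<longrightarrow> (\<forall>j. h_bar P (euler_step P dt U) j \<ge> 0))
       \<and> (\<forall>\<kappa> g \<epsilon> \<theta>. \<kappa> > 0 \<and> g > 0 \<and> \<epsilon> > 0 \<and> 1 \<le> \<theta> \<and> \<theta> \<le> 2
            \<longrightarrow> (\<exists>P U dt. admissible P \<and> grav P = g \<and> eps P = \<epsilon> \<and> theta P = \<theta>
                  \<and> dt > 0 \<and> (\<forall>j. h_bar P U j \<ge> 0) \<and> cfl P U dt \<kappa>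
                  \<and> \<not> time_step_ok a_cell P U dt \<and> \<not> time_step_ok a_face P U dt))"
  using euler_step_nonneg cfl_not_sufficient by blast

end
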